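(* Let $n\ge 1$, let $\mathbb{R}[t]$ be the ring of polynomials in one variable $t$ with real coefficients, and let $\mathcal{G}\subseteq\mathcal{S}_n(\mathbb{R}[t])$ be a finite set. If $\mathbf{K}_{\mathcal{G}}$ is compact, then $\mathcal{M}_{\mathcal{G}}$ is Archimedean.
   Context: $\mathcal{M}_n(\mathbb{R}[t])$ is the ring of $n\times n$ matrices over $\mathbb{R}[t]$, $\mathcal{S}_n(\mathbb{R}[t])$ its subset of symmetric matrices, $\mathbf{I}_n$ the identity matrix. A quadratic module in $\mathcal{M}_n(\mathbb{R}[t])$ is a set $\mathcal{M}\subseteq\mathcal{S}_n(\mathbb{R}[t])$ with $\mathbf{I}_n\in\mathcal{M}$, $\mathcal{M}+\mathcal{M}\subseteq\mathcal{M}$, and $A^T\mathcal{M}A\subseteq\mathcal{M}$ for all $A\in\mathcal{M}_n(\mathbb{R}[t])$. $\mathcal{M}_{\mathcal{G}}$ is the smallest quadratic module containing $\mathcal{G}$, i.e. the set of all finite sums $\sum_{i,j}A_{ij}^TG_iA_{ij}$ with $G_i\in\mathcal{G}\cup\{\mathbf{I}_n\}$, $A_{ij}\in\mathcal{M}_n(\mathbb{R}[t])$. A quadratic module $\mathcal{M}$ is Archimedean if for each $\mathbf{A}\in\mathcal{M}_n(\mathbb{R}[t])$ there is $k\in\mathbb{N}$ such that $k\cdot\mathbf{I}_n-\mathbf{A}^T\mathbf{A}\in\mathcal{M}$. $\mathbf{K}_{\mathcal{G}}=\{x\in\mathbb{R}:\mathbf{G}(x)\text{ is positive semidefinite for all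 }\mathbf{G}\in\mathcal{G}\}$. *)

theory Defs
  imports Complex_Main "HOL-Computational_Algebra.Polynomial" "Jordan_Normal_Form.Matrix"
begin

definition symmetric_mats :: "nat \<Rightarrow> 'a mat set" where
  "symmetric_mats n = {A \<in> carrier_mat n n. transpose_mat A = A}"

definition positive_semidefinite :: "nat \<Rightarrow> real mat \<Rightarrow> bool" where
  "positive_semidefinite n A \<longleftrightarrow>
     A \<in> symmetric_mats n \<and> (\<forall>v \<in> carrier_vec n. 0 \<le> v \<bullet> (A *\<^sub>v v))"

definition eval_mat :: "real poly mat \<Rightarrow> real \<Rightarrow> real mat" where
  "eval_mat G x = map_mat (\<lambda>p. poly p x) G"

definition psd_locus :: "nat \<Rightarrow> real poly mat set \<Rightarrow> real set" where
  "psd_locus n \<G> = {x. \<forall>G \<in> \<G>. positive_semidefinite n (eval_mat G x)}"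

definition quadratic_module :: "nat \<Rightarrow> real poly mat set \<Rightarrow> bool" where
  "quadratic_module n M \<longleftrightarrow>
     M \<subseteq> symmetric_mats n \<and>
     1\<^sub>m n \<in> M \<and>
     (\<forall>B \<in> M. \<forall>C \<in> M. B + C \<in> M) \<and>
     (\<forall>A \<in> carrier_mat n n. \<forall>B \<in> M. transpose_mat A * B * A \<in> M)"

definition generated_quadratic_module :: "nat \<Rightarrow> real poly mat set \<Rightarrow> real poly mat set" where
  "generated_quadratic_module n \<G> = \<Inter> {M. quadratic_module n M \<and> \<G> \<subseteq> M}"

definition archimedean :: "nat \<Rightarrow> real poly mat set \<Rightarrow> bool" where
  "archimedean n M \<longleftrightarrow>
     (\<forall>A \<in> carrier_mat n n. \<exists>k::nat. of_nat k \<cdot>\<^sub>m 1\<^sub>m n - transpose_mat A * A \<in> M)"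

lemma symmetric_mats_add:
  assumes "B \<in> symmetric_mats n" "C \<in> symmetric_mats n"
  shows "B + C \<in> symmetric_mats n"
  using assms by (auto simp: symmetric_mats_def transpose_add)

lemma symmetric_mats_congruence:
  fixes A B :: "'a::comm_ring_1 mat"
  assumes A: "A \<in> carrier_mat n n" and B: "B \<in> symmetric_mats n"
  shows "transpose_mat A * B * A \<in> symmetric_mats n"
proof -
  have B': "B \<in> carrier_mat n n" "transpose_mat B = B"
    using B by (auto simp: symmetric_mats_def)
  have At: "transpose_mat A \<in> carrier_mat n n" using A by simp
  have "transpose_mat (transpose_mat A * B * A)
      = transpose_mat A * transpose_mat (transpose_mat A * B)"
    by (rule transpose_mult[where n = n and nr = n and nc = n]) (use A B' in auto)
  also have "transpose_mat (transpose_mat A * B) = B * A"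
    using transpose_mult[OF At B'(1)] B'(2) by simp
  also have "transpose_mat A * (B * A) = transpose_mat A * B * A"
    using assoc_mult_mat[OF At B'(1) A] by simp
  finally show ?thesis using A B' by (auto simp: symmetric_mats_def)
qed

lemma quadratic_module_symmetric_mats:
  "quadratic_module n (symmetric_mats n)"
  unfolding quadratic_module_def
  by (auto intro: symmetric_mats_add symmetric_mats_congruence) (simp add: symmetric_mats_def)

text \<open>
  For symmetric generators the family intersected in \<open>generated_quadratic_module\<close> is
  nonempty, so the intersection is the smallest quadratic module containing the generators.
\<close>

lemma generated_quadratic_module_least:
  assumes "\<G> \<subseteq> symmetric_mats n"
  shows "quadratic_module n (generated_quadratic_module n \<G>)"
    and "\<G> \<subseteq> generated_quadratic_module n \<G>"
    and "\<And>M. quadratic_module n M \<Longrightarrow> \<G> \<subseteq> M \<Longrightarrow> generated_quadratic_module n \<G> \<subseteq> M"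
proof -
  have "generated_quadratic_module n \<G> \<subseteq> symmetric_mats n"
    using assms quadratic_module_symmetric_mats by (auto simp: generated_quadratic_module_def)
  then show "quadratic_module n (generated_quadratic_module n \<G>)"
    unfolding quadratic_module_def[of n "generated_quadratic_module n \<G>"]
    by (auto simp: generated_quadratic_module_def quadratic_module_def)
qed (auto simp: generated_quadratic_module_def)

text \<open>The same set as finite sums; each pair \<open>(A, G)\<close> in the list is one summand.\<close>

definition congruence_sum :: "nat \<Rightarrow> (real poly mat \<times> real poly mat) list \<Rightarrow> real poly mat" where
  "congruence_sum n ps = foldr (\<lambda>(A, G) S. transpose_mat A * G * A + S) ps (0\<^sub>m n n)"

lemma congruence_sum_simps [simp]:
  "congruence_sum n [] = 0\<^sub>m n n"
  "congruence_sum n ((A, G) # ps) = transpose_mat A * G * A + congruence_sum n ps"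
  by (simp_all add: congruence_sum_def)

lemma congruence_sum_in_quadratic_module:
  assumes "quadratic_module n M" and "set ps \<subseteq> carrier_mat n n \<times> M"
  shows "congruence_sum n ps \<in> M"
  using assms(2)
proof (induction ps)
  case Nil
  have "transpose_mat (0\<^sub>m n n) * 1\<^sub>m n * 0\<^sub>m n n \<in> M"
    using assms(1) zero_carrier_mat[of n n] unfolding quadratic_module_def by metis
  then show ?case by simp
next
  case (Cons p ps)
  obtain A G where p: "p = (A, G)" by (cases p)
  have "A \<in> carrier_mat n n" "G \<in> M" using Cons.prems p by auto
  then have "transpose_mat A * G * A \<in> M"
    using assms(1) unfolding quadratic_module_def by metis
  moreover have "congruence_sum n ps \<in> M" using Cons by simp
  ultimately have "transpose_mat A * G * A + congruence_sum n ps \<in> M"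
    using assms(1) unfolding quadratic_module_def by metis
  then show ?case using p by simp
qed

lemma congruence_sum_append:
  assumes "set ps \<subseteq> carrier_mat n n \<times> carrier_mat n n"
    and "set qs \<subseteq> carrier_mat n n \<times> carrier_mat n n"
  shows "congruence_sum n (ps @ qs) = congruence_sum n ps + congruence_sum n qs
    \<and> congruence_sum n ps \<in> carrier_mat n n \<and> congruence_sum n qs \<in> carrier_mat n n"
proof -
  have car: "set rs \<subseteq> carrier_mat n n \<times> carrier_mat n n \<Longrightarrow> congruence_sum n rs \<in> carrier_mat n n"
    for rs by (induction rs) auto
  have "congruence_sum n (ps @ qs) = congruence_sum n ps + congruence_sum n qs"
    using assms(1)
  proof (induction ps)
    case Nil
    then show ?case using car[OF assms(2)] by simp
  next
    case (Cons p ps)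
    obtain A G where p: "p = (A, G)" by (cases p)
    have AG: "transpose_mat A * G * A \<in> carrier_mat n n" and ps: "congruence_sum n ps \<in> carrier_mat n n"
      using Cons.prems car p by auto
    then show ?case
      using Cons p assoc_add_mat[OF AG ps car[OF assms(2)]] by simp
  qed
  with car assms show ?thesis by blast
qed

lemma congruence_sum_congruence:
  assumes A: "A \<in> carrier_mat n n" and ps: "set ps \<subseteq> carrier_mat n n \<times> carrier_mat n n"
  shows "transpose_mat A * congruence_sum n ps * A
    = congruence_sum n (map (\<lambda>(B, G). (B * A, G)) ps)"
  using ps
proof (induction ps)
  case Nil
  then show ?case using A by simp
next
  case (Cons p ps)
  obtain B G where p: "p = (B, G)" by (cases p)
  have B: "B \<in> carrier_mat n n" and G: "G \<in> carrier_mat n n"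
    and S: "congruence_sum n ps \<in> carrier_mat n n"
    using Cons.prems p congruence_sum_append[of ps n ps] by auto
  have At: "transpose_mat A \<in> carrier_mat n n" and Bt: "transpose_mat B \<in> carrier_mat n n"
    using A B by auto
  have AtBtG: "transpose_mat B * G \<in> carrier_mat n n" and T: "transpose_mat B * G * B \<in> carrier_mat n n"
    and AtT: "transpose_mat A * (transpose_mat B * G * B) \<in> carrier_mat n n"
    and AtS: "transpose_mat A * congruence_sum n ps \<in> carrier_mat n n"
    and BA: "B * A \<in> carrier_mat n n" and GBA: "G * (B * A) \<in> carrier_mat n n"
    using A B G S At Bt by auto
  have "transpose_mat A * (transpose_mat B * G * B + congruence_sum n ps) * A
      = transpose_mat A * (transpose_mat B * G * B) * A + transpose_mat A * congruence_sum n ps * A"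
    using mult_add_distrib_mat[OF At T S] add_mult_distrib_mat[OF AtT AtS A] by argo
  moreover have "transpose_mat A * (transpose_mat B * G * B) * A
      = transpose_mat (B * A) * G * (B * A)"
  proof -
    have "transpose_mat A * (transpose_mat B * G * B) * A
        = transpose_mat A * (transpose_mat B * G * B * A)"
      by (rule assoc_mult_mat[OF At T A])
    also have "transpose_mat B * G * B * A = transpose_mat B * G * (B * A)"
      by (rule assoc_mult_mat[OF AtBtG B A])
    also have "\<dots> = transpose_mat B * (G * (B * A))"
      by (rule assoc_mult_mat[OF Bt G BA])
    also have "transpose_mat A * (transpose_mat B * (G * (B * A)))
        = transpose_mat A * transpose_mat B * (G * (B * A))"
      by (rule assoc_mult_mat[OF At Bt GBA, symmetric])
    also have "\<dots> = transpose_mat A * transpose_mat B * G * (B * A)"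
      by (rule assoc_mult_mat[OF mult_carrier_mat[OF At Bt] G BA, symmetric])
    finally show ?thesis unfolding transpose_mult[OF B A] .
  qed
  ultimately show ?case
    using Cons p by simp
qed

lemma generated_quadratic_module_eq_sums:
  assumes "\<G> \<subseteq> symmetric_mats n"
  shows "generated_quadratic_module n \<G>
    = {congruence_sum n ps | ps. set ps \<subseteq> carrier_mat n n \<times> insert (1\<^sub>m n) \<G>}" (is "_ = ?S")
proof
  let ?H = "insert (1\<^sub>m n) \<G>"
  have Hsym: "?H \<subseteq> symmetric_mats n" and Hcar: "?H \<subseteq> carrier_mat n n"
    using assms by (auto simp: symmetric_mats_def)
  have single: "G \<in> ?S" if "G \<in> ?H" for G
  proof -
    have "congruence_sum n [(1\<^sub>m n, G)] = G" using that Hcar by auto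
    moreover have "set [(1\<^sub>m n, G)] \<subseteq> carrier_mat n n \<times> ?H" using that by auto
    ultimately show ?thesis by (metis (mono_tags, lifting) mem_Collect_eq)
  qed
  have "quadratic_module n ?S"
    unfolding quadratic_module_def
  proof (intro conjI ballI subsetI)
    fix B assume "B \<in> ?S"
    then obtain ps where ps: "B = congruence_sum n ps" "set ps \<subseteq> carrier_mat n n \<times> ?H" by blast
    then show "B \<in> symmetric_mats n"
      using congruence_sum_in_quadratic_module[OF quadratic_module_symmetric_mats, of ps n] Hsym by auto
  next
    show "1\<^sub>m n \<in> ?S" by (rule single) simp
  next
    fix B C assume "B \<in> ?S" "C \<in> ?S"
    then obtain ps qs where ps: "B = congruence_sum n ps" "set ps \<subseteq> carrier_mat n n \<times> ?H"
      and qs: "C = congruence_sum n qs" "set qs \<subseteq> carrier_mat n n \<times> ?H" by blast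
    have "set ps \<subseteq> carrier_mat n n \<times> carrier_mat n n"
      and "set qs \<subseteq> carrier_mat n n \<times> carrier_mat n n" using ps qs Hcar by blast+
    then have "B + C = congruence_sum n (ps @ qs)"
      using congruence_sum_append ps(1) qs(1) by simp
    moreover have "set (ps @ qs) \<subseteq> carrier_mat n n \<times> ?H" using ps qs by auto
    ultimately show "B + C \<in> ?S" by blast
  next
    fix A B :: "real poly mat" assume A: "A \<in> carrier_mat n n" and "B \<in> ?S"
    then obtain ps where ps: "B = congruence_sum n ps" "set ps \<subseteq> carrier_mat n n \<times> ?H" by blast
    have "set ps \<subseteq> carrier_mat n n \<times> carrier_mat n n" using ps Hcar by blast
    then have "transpose_mat A * B * A = congruence_sum n (map (\<lambda>(B, G). (B * A, G)) ps)"
      using congruence_sum_congruence[OF A] ps(1) by simp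
    moreover have "set (map (\<lambda>(B, G). (B * A, G)) ps) \<subseteq> carrier_mat n n \<times> ?H"
      using ps(2) A by auto
    ultimately show "transpose_mat A * B * A \<in> ?S" by blast
  qed
  moreover have "\<G> \<subseteq> ?S" using single by blast
  ultimately show "generated_quadratic_module n \<G> \<subseteq> ?S"
    using generated_quadratic_module_least(3)[OF assms] by blast
next
  show "?S \<subseteq> generated_quadratic_module n \<G>"
  proof
    fix B assume "B \<in> ?S"
    then obtain ps where ps: "B = congruence_sum n ps"
      "set ps \<subseteq> carrier_mat n n \<times> insert (1\<^sub>m n) \<G>" by blast
    have Q: "quadratic_module n (generated_quadratic_module n \<G>)"
      by (rule generated_quadratic_module_least(1)[OF assms])
    have "insert (1\<^sub>m n) \<G> \<subseteq> generated_quadratic_module n \<G>"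
      using Q generated_quadratic_module_least(2)[OF assms] by (auto simp: quadratic_module_def)
    then show "B \<in> generated_quadratic_module n \<G>"
      using congruence_sum_in_quadratic_module[OF Q, of ps] ps by blast
  qed
qed

end

theory Submission
  imports Defs
begin

text \<open>
  Order \<open>\<real>[t]\<close> by the sign of the leading coefficient, that is, by the germs at \<open>+\<infinity>\<close>.
  If all values \<open>v\<^sup>T G v\<close> with \<open>v\<close> over \<open>\<real>[t]\<close> are nonnegative in this order, then successive
  Schur complements show that \<open>G(x)\<close> is positive semidefinite for all large \<open>x\<close>. As the locus is
  bounded, some generator must therefore have a value \<open>g = v\<^sup>T G v\<close> that is negative near
  \<open>+\<infinity>\<close>, and similarly some \<open>h\<close> is negative near \<open>-\<infinity>\<close>; the scalar matrices
  \<open>g I\<close> and \<open>h I\<close> lie in the module. Combining \<open>g\<close> and \<open>h\<close> yields a \<open>p\<close> of even degree with negative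
  leading coefficient. For any \<open>f\<close> the polynomial \<open>k - f - t\<^sup>2\<^sup>m p\<close> is then nonnegative on the real
  line for large \<open>m\<close> and \<open>k\<close>, hence a sum of squares, so \<open>(k - f) I\<close> lies in the module. Apply
  this to \<open>f = tr (A\<^sup>T A)\<close>: by Lagrange's identity \<open>f I - A\<^sup>T A\<close> is a sum of squares.
\<close>

section \<open>Quadratic forms over commutative rings\<close>

text \<open>Coefficients and vectors are functions, so an induction on \<open>n\<close> can drop the
  last variable without changing them.\<close>

definition qform :: "nat \<Rightarrow> (nat \<Rightarrow> nat \<Rightarrow> 'a::comm_ring_1) \<Rightarrow> (nat \<Rightarrow> 'a) \<Rightarrow> 'a" where
  "qform n G v = (\<Sum>i<n. \<Sum>j<n. G i j * v i * v j)"

lemma poly_qform: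
  "poly (qform n G v) x = qform n (\<lambda>i j. poly (G i j) x) (\<lambda>i. poly (v i) x)"
  by (simp add: qform_def poly_sum)

text \<open>Expansion in the last variable \<open>s\<close>; symmetry merges the two cross
  terms.\<close>

lemma qform_fun_upd:
  assumes "\<And>i j. G i j = G j i"
  shows "qform (Suc n) G (v(n := s)) = qform n G v + 2 * s * (\<Sum>i<n. G i n * v i) + G n n * s\<^sup>2"
proof -
  have "(\<Sum>j<n. G n j * s * v j) = s * (\<Sum>i<n. G i n * v i)"
    unfolding sum_distrib_left by (intro sum.cong refl) (simp add: assms[of n])
  then show ?thesis
    by (simp add: qform_def sum.distrib sum_distrib_left power2_eq_square algebra_simps)
qed

lemma qform_scale: "qform n G (\<lambda>i. c * v i) = c\<^sup>2 * qform n G v"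
  by (simp add: qform_def sum_distrib_left power2_eq_square algebra_simps)

text \<open>With \<open>w\<close> the last column and \<open>g\<close> the corner entry, this is the
  Schur complement multiplied by \<open>g\<close>, which avoids division in \<real>[t].\<close>

lemma qform_schur_complement:
  "qform n (\<lambda>i j. g * G i j - w i * w j) v = g * qform n G v - (\<Sum>i<n. w i * v i)\<^sup>2"
proof -
  have "(\<Sum>i<n. w i * v i)\<^sup>2 = (\<Sum>i<n. \<Sum>j<n. w i * w j * v i * v j)"
    unfolding power2_eq_square sum_product by (intro sum.cong refl) (simp add: algebra_simps)
  then show ?thesis
    by (simp add: qform_def sum_distrib_left sum_subtractf algebra_simps)
qed

section \<open>The order on \<real>[t] by germs at +\<infinity>\<close>

lemma eventually_poly_pos:
  fixes p :: "real poly"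
  assumes "0 < p"
  shows "\<forall>\<^sub>F x in at_top. 0 < poly p x"
proof -
  have "0 < lead_coeff p"
    using assms by (simp add: less_poly_def pos_poly_def)
  then show ?thesis
    using poly_pinfty_gt_lc[of p] by (fastforce simp: eventually_at_top_linorder)
qed

lemma
  fixes p q :: "'a::ring_1 poly"
  assumes "degree q < degree p"
  shows degree_diff_eq_left: "degree (p - q) = degree p"
    and lead_coeff_diff_eq_left: "lead_coeff (p - q) = lead_coeff p"
  using degree_add_eq_left[of "- q" p] assms by (simp_all add: coeff_eq_0)

text \<open>The order is non-Archimedean: for nonzero \<open>b\<close> and
  \<open>s = - t^k * b\<close> with \<open>k > degree a\<close>, the term
  \<open>s * b = - t^k * b^2\<close> outweighs \<open>a\<close>.\<close>

lemma poly_linear_nonneg_imp_zero: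
  fixes a b :: "real poly"
  assumes "\<And>s. 0 \<le> a + s * b"
  shows "b = 0"
proof (rule ccontr)
  assume b: "b \<noteq> 0"
  define c where "c = monom 1 (Suc (degree a)) * b * b"
  have deg: "degree a < degree c"
    using b by (simp add: c_def degree_mult_eq degree_monom_eq monom_eq_0_iff)
  have "lead_coeff c = (lead_coeff b)\<^sup>2"
    by (simp add: c_def lead_coeff_mult power2_eq_square degree_monom_eq)
  moreover have "degree (c - a) = degree c" and "lead_coeff (c - a) = lead_coeff c"
    using deg by (blast intro: degree_diff_eq_left lead_coeff_diff_eq_left)+
  ultimately have "pos_poly (c - a)"
    using b by (simp add: pos_poly_def)
  then have "a < c" by (simp add: less_poly_def)
  moreover have "0 \<le> a + (- (monom 1 (Suc (degree a)) * b)) * b" by (rule assms)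
  ultimately show False by (simp add: c_def)
qed

text \<open>Induction on \<open>n\<close>: the corner entry is either zero, and then the last column
  vanishes, or positive, and then the Schur complement inherits both hypotheses.\<close>

lemma qform_eventually_nonneg:
  fixes G :: "nat \<Rightarrow> nat \<Rightarrow> real poly"
  assumes "\<And>i j. G i j = G j i" and "\<And>v. 0 \<le> qform n G v"
  shows "\<forall>\<^sub>F x in at_top. \<forall>v. 0 \<le> qform n (\<lambda>i j. poly (G i j) x) v"
  using assms
proof (induction n arbitrary: G)
  case 0
  then show ?case by (simp add: qform_def)
next
  case (Suc n)
  define g where "g = G n n"
  define L where "L v = (\<Sum>i<n. G i n * v i)" for v
  have ext: "0 \<le> qform n G v + 2 * s * L v + g * s\<^sup>2" for v s
    using Suc.prems(2)[of "v(n := s)"] qform_fun_upd[of G n v s] Suc.prems(1)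
    by (simp add: L_def g_def del: fun_upd_apply)
  have real_ext: "qform (Suc n) (\<lambda>i j. poly (G i j) x) v
      = qform n (\<lambda>i j. poly (G i j) x) v + 2 * v n * (\<Sum>i<n. poly (G i n) x * v i)
        + poly g x * (v n)\<^sup>2" for x v
    using qform_fun_upd[of "\<lambda>i j. poly (G i j) x" n v "v n"] Suc.prems(1) by (simp add: g_def)
  show ?case
  proof (cases "g = 0")
    case True
    \<comment> \<open>With \<open>g = 0\<close> the value is affine in \<open>s\<close>, which
      forces the linear term to vanish; unit vectors then show that the last column is zero.\<close>
    have L0: "L v = 0" for v
    proof -
      have "0 \<le> qform n G v + s * (2 * L v)" for s
        using ext[of v s] True by (simp add: algebra_simps)
      then show ?thesis using poly_linear_nonneg_imp_zero by fastforce
    qed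
    have "G i n = 0" if "i < n" for i
    proof -
      have "L (\<lambda>k. if k = i then 1 else 0) = G i n"
        using that by (simp add: L_def if_distrib[of "(*) _"] cong: if_cong)
      then show ?thesis using L0 by metis
    qed
    then have "qform (Suc n) (\<lambda>i j. poly (G i j) x) v = qform n (\<lambda>i j. poly (G i j) x) v" for x v
      using True by (simp add: real_ext)
    moreover have "0 \<le> qform n G v" for v
      using ext[of v 0] by simp
    ultimately show ?thesis using Suc.IH[of G] Suc.prems(1) by simp
  next
    case False
    have "0 \<le> g"
      using ext[of "\<lambda>_. 0" 1] by (simp add: L_def qform_def)
    with False have g: "0 < g" by simp
    define S where "S i j = g * G i j - G i n * G j n" for i j
    have "0 \<le> qform n S v" for v
    proof -
      \<comment> \<open>The minimising last coordinate for \<open>v\<close> is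
        \<open>- L v / g\<close>; scaling the whole vector by \<open>g\<close> clears the
        denominator.\<close>
      have "L (\<lambda>i. g * v i) = g * L v"
        by (simp add: L_def sum_distrib_left algebra_simps)
      then have "0 \<le> g\<^sup>2 * qform n G v + 2 * (- L v) * (g * L v) + g * (- L v)\<^sup>2"
        using ext[of "\<lambda>i. g * v i" "- L v"] by (simp add: qform_scale)
      also have "\<dots> = g * (g * qform n G v - (L v)\<^sup>2)"
        by (simp add: power2_eq_square algebra_simps)
      also have "g * qform n G v - (L v)\<^sup>2 = qform n S v"
        unfolding S_def L_def qform_schur_complement ..
      finally show ?thesis using g by (simp add: zero_le_mult_iff)
    qed
    moreover have "S i j = S j i" for i j
      by (simp add: S_def Suc.prems(1)[of i j])
    ultimately have "\<forall>\<^sub>F x in at_top. \<forall>v. 0 \<le> qform n (\<lambda>i j. poly (S i j) x) v"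
      by (intro Suc.IH) auto
    then show ?thesis
      using eventually_poly_pos[OF g]
    proof eventually_elim
      case (elim x)
      show ?case
      proof
        fix v :: "nat \<Rightarrow> real"
        let ?q = "qform n (\<lambda>i j. poly (G i j) x) v" and ?l = "\<Sum>i<n. poly (G i n) x * v i"
        have "0 \<le> poly g x * ?q - ?l\<^sup>2"
          using elim(1) by (simp add: S_def qform_schur_complement)
        \<comment> \<open>The added square completes the value of the Schur complement to
          \<open>poly g x\<close> times the full form.\<close>
        then have "0 \<le> (poly g x * ?q - ?l\<^sup>2) + (poly g x * v n + ?l)\<^sup>2"
          by simp
        also have "\<dots> = poly g x * qform (Suc n) (\<lambda>i j. poly (G i j) x) v"
          unfolding real_ext by (simp add: power2_eq_square algebra_simps)
        finally show "0 \<le> qform (Suc n) (\<lambda>i j. poly (G i j) x) v"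
          using elim(2) by (simp add: zero_le_mult_iff)
      qed
    qed
  qed
qed

section \<open>Reflection, minima and signs of real polynomials\<close>

text \<open>Carries behaviour at -\<infinity> to +\<infinity>, so that only one end of the line
  needs an order.\<close>

definition poly_reflect :: "real poly \<Rightarrow> real poly" where
  "poly_reflect p = pcompose p [:0, -1:]"

lemma poly_poly_reflect [simp]: "poly (poly_reflect p) x = poly p (- x)"
  by (simp add: poly_reflect_def poly_pcompose)

lemma degree_poly_reflect [simp]: "degree (poly_reflect p) = degree p"
  by (simp add: poly_reflect_def degree_pcompose)

lemma lead_coeff_poly_reflect: "lead_coeff (poly_reflect p) = (-1) ^ degree p * lead_coeff p"
  using lead_coeff_comp[of "[:0, -1:]" p] by (simp add: poly_reflect_def)

lemma qform_poly_reflect: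
  "poly_reflect (qform n G v) = qform n (\<lambda>i j. poly_reflect (G i j)) (\<lambda>i. poly_reflect (v i))"
  by (rule iffD1[OF poly_eq_poly_eq_iff], rule ext) (simp add: poly_qform)

text \<open>Outside some interval the values exceed \<open>poly p 0\<close>, so the minimum over
  that compact interval is global.\<close>

lemma poly_attains_min:
  fixes p :: "real poly"
  assumes "even (degree p)" "0 < lead_coeff p"
  shows "\<exists>a. \<forall>x. poly p a \<le> poly p x"
proof (cases "degree p = 0")
  case True
  then show ?thesis by (auto elim: degree_eq_zeroE)
next
  case False
  define q where "q = p - [:poly p 0:]"
  have q: "degree q = degree p" "lead_coeff q = lead_coeff p"
    unfolding q_def using False
    by (intro degree_diff_eq_left lead_coeff_diff_eq_left; simp)+
  have "0 < q" "0 < poly_reflect q"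
    using q assms lead_coeff_poly_reflect[of q] by (auto simp: less_poly_def pos_poly_def)
  then have "\<forall>\<^sub>F x in at_top. 0 < poly q x \<and> 0 < poly q (- x)"
    using eventually_poly_pos[of q] eventually_poly_pos[of "poly_reflect q"]
    by (simp add: eventually_conj_iff)
  then obtain N where N: "\<And>x. x \<ge> N \<Longrightarrow> poly p 0 < poly p x \<and> poly p 0 < poly p (- x)"
    by (auto simp: eventually_at_top_linorder q_def)
  \<comment> \<open>The maximum with 0 keeps the comparison point 0 inside the interval.\<close>
  define b where "b = max N 0"
  have "\<exists>a\<in>{-b..b}. \<forall>x\<in>{-b..b}. poly p a \<le> poly p x"
    by (rule continuous_attains_inf) (auto simp: b_def intro!: continuous_intros)
  then obtain a where a: "\<And>x. x \<in> {-b..b} \<Longrightarrow> poly p a \<le> poly p x" by blast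
  have "poly p a \<le> poly p x" for x
  proof (cases "x \<in> {-b..b}")
    case False
    then have "x \<ge> N \<or> - x \<ge> N" by (auto simp: b_def)
    then have "poly p 0 < poly p x" using N[of x] N[of "- x"] by auto
    moreover have "poly p a \<le> poly p 0" by (rule a) (simp add: b_def)
    ultimately show ?thesis by simp
  qed (rule a)
  then show ?thesis by blast
qed

text \<open>A nonnegative polynomial is not eventually negative. Applied to the reflection as well,
  this makes \<open>(-1) ^ degree p\<close> positive, hence the degree even.\<close>

lemma nonneg_poly_lead_coeff:
  fixes p :: "real poly"
  assumes "\<And>x. 0 \<le> poly p x" "p \<noteq> 0"
  shows "even (degree p)" "0 < lead_coeff p"
proof -
  have pos: "0 < lead_coeff q" if "\<And>x. 0 \<le> poly q x" "q \<noteq> 0" for q :: "real poly"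
  proof (rule ccontr)
    assume "\<not> 0 < lead_coeff q"
    then have "0 < - q" using that(2) by (simp add: less_poly_def pos_poly_def less_le)
    then obtain x where "0 < poly (- q) x"
      using eventually_happens[OF eventually_poly_pos] by fastforce
    then show False using that(1)[of x] by simp
  qed
  show "0 < lead_coeff p" by (rule pos[OF assms])
  moreover have "0 < lead_coeff (poly_reflect p)"
  proof (rule pos)
    show "poly_reflect p \<noteq> 0"
      using assms(2) lead_coeff_poly_reflect[of p] by auto
  qed (simp add: assms)
  ultimately show "even (degree p)"
    unfolding lead_coeff_poly_reflect by (cases "even (degree p)") auto
qed

section \<open>Quadratic modules in \<real>[t]\<close>

definition poly_quadratic_module :: "real poly set \<Rightarrow> bool" where
  "poly_quadratic_module P \<longleftrightarrow>
     1 \<in> P \<and> (\<forall>p\<in>P. \<forall>q\<in>P. p + q \<in> P) \<and> (\<forall>a. \<forall>p\<in>P. a\<^sup>2 * p \<in> P)"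

lemma poly_quadratic_moduleD:
  assumes "poly_quadratic_module P"
  shows "1 \<in> P" "p \<in> P \<Longrightarrow> q \<in> P \<Longrightarrow> p + q \<in> P" "p \<in> P \<Longrightarrow> a\<^sup>2 * p \<in> P"
  using assms by (auto simp: poly_quadratic_module_def)

lemma poly_quadratic_module_smult:
  assumes "poly_quadratic_module P" "p \<in> P" "0 \<le> c"
  shows "Polynomial.smult c p \<in> P"
  using poly_quadratic_moduleD(3)[OF assms(1,2), of "[:sqrt c:]"] assms(3)
  by (simp add: power2_eq_square)

text \<open>Splitting off the minimum \<open>m = p(a)\<close> writes \<open>p = m + (t - a)\<^sup>2 q\<close> with \<open>q\<close>
  nonnegative of smaller degree.\<close>

lemma nonneg_poly_in_poly_quadratic_module:
  assumes P: "poly_quadratic_module P" and nonneg: "\<And>x. 0 \<le> poly p x"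
  shows "p \<in> P"
  using nonneg
proof (induction "degree p" arbitrary: p rule: less_induct)
  case less
  have const: "[:c:] \<in> P" if "0 \<le> c" for c
    using poly_quadratic_module_smult[OF P poly_quadratic_moduleD(1)[OF P] that] by simp
  show ?case
  proof (cases "degree p = 0")
    case True
    then obtain c where "p = [:c:]" by (rule degree_eq_zeroE)
    then show ?thesis using const less.prems by simp
  next
    case False
    then have "p \<noteq> 0" by auto
    with less.prems obtain a where a: "\<And>x. poly p a \<le> poly p x"
      using poly_attains_min nonneg_poly_lead_coeff by blast
    define r where "r = p - [:poly p a:]"
    have r: "0 \<le> poly r x" for x using a by (simp add: r_def)
    have "poly r a = 0" by (simp add: r_def)
    then obtain s where s: "r = [:- a, 1:] * s" by (auto simp: poly_eq_0_iff_dvd elim: dvdE)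
    have "degree r = degree p"
      unfolding r_def using False by (intro degree_diff_eq_left) simp
    then have "s \<noteq> 0" using s False by auto
    \<comment> \<open>The root \<open>a\<close> of \<open>r\<close> is a minimum, so it is at least
      double; this yields the second linear factor.\<close>
    have "poly (pderiv r) a = 0"
    proof (rule DERIV_local_min[of "poly r" _ a 1])
      show "\<forall>y. \<bar>a - y\<bar> < 1 \<longrightarrow> poly r a \<le> poly r y"
        using r \<open>poly r a = 0\<close> by simp
    qed (simp_all add: poly_DERIV)
    then have "poly s a = 0" unfolding s pderiv_mult by (simp add: pderiv_pCons)
    then obtain q where q: "s = [:- a, 1:] * q" by (auto simp: poly_eq_0_iff_dvd elim: dvdE)
    have rq: "r = [:- a, 1:]\<^sup>2 * q" by (simp only: s q power2_eq_square mult.assoc)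
    have "q \<noteq> 0" using q \<open>s \<noteq> 0\<close> by auto
    then have "degree q < degree p"
      using \<open>degree r = degree p\<close> unfolding rq by (simp add: degree_mult_eq degree_power_eq)
    moreover have "0 \<le> poly q x" for x
    proof -
      have pos: "0 \<le> poly q y" if "y \<noteq> a" for y
        using r[of y] that by (simp add: rq zero_le_mult_iff)
      \<comment> \<open>Cancelling the square says nothing at \<open>a\<close> itself; continuity
        fills that point.\<close>
      have "\<forall>\<^sub>F y in at x. 0 \<le> poly q y"
        using eventually_neq_at_within[of a x UNIV] by eventually_elim (rule pos)
      moreover have "(poly q \<longlongrightarrow> poly q x) (at x)"
        using poly_isCont isCont_def by blast
      ultimately show ?thesis by (intro tendsto_lowerbound) auto
    qed
    ultimately have "q \<in> P" by (rule less.hyps)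
    then have "[:- a, 1:]\<^sup>2 * q + [:poly p a:] \<in> P"
      using less.prems by (intro poly_quadratic_moduleD[OF P] const) auto
    then show ?thesis unfolding rq[symmetric] by (simp add: r_def)
  qed
qed

text \<open>The leading terms of \<open>(t - c)\<^sup>2 g\<close> and \<open>t\<^sup>2 h\<close> cancel, and the next coefficient
  is affine in \<open>c\<close>.\<close>

lemma cancel_odd_degree:
  fixes g h :: "real poly"
  assumes P: "poly_quadratic_module P" and gh: "g \<in> P" "h \<in> P"
    and deg: "degree g = degree h" "odd (degree g)"
    and lead: "lead_coeff g = -1" "lead_coeff h = 1"
  shows "\<exists>p\<in>P. even (degree p) \<and> lead_coeff p < 0"
proof -
  obtain d where d: "degree g = Suc d" using deg(2) by (cases "degree g") auto
  \<comment> \<open>The coefficient of \<open>p\<close> at \<open>d + 2\<close> is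
    \<open>coeff g d + coeff h d + 2 * c\<close>; this \<open>c\<close> makes it -1.\<close>
  define c where "c = - (1 + coeff g d + coeff h d) / 2"
  define p where "p = [:- c, 1:]\<^sup>2 * g + [:0, 1:]\<^sup>2 * h"
  have p: "p = pCons 0 (pCons 0 (g + h)) - Polynomial.smult (2 * c) (pCons 0 g) + Polynomial.smult (c\<^sup>2) g"
    by (simp add: p_def power2_eq_square algebra_simps)
  have "p \<in> P" unfolding p_def by (intro poly_quadratic_moduleD[OF P] gh)
  moreover have 1: "coeff p (Suc (Suc d)) = -1"
    using lead d deg by (simp add: p c_def coeff_eq_0 field_simps)
  moreover have "degree p = Suc (Suc d)"
  proof (rule antisym)
    show "degree p \<le> Suc (Suc d)"
    proof (rule degree_le, intro allI impI)
      fix i assume i: "Suc (Suc d) < i"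
      then obtain k where k: "i = Suc (Suc k)" "d < k" by (metis Suc_lessE Suc_less_SucD)
      \<comment> \<open>At \<open>k = Suc d\<close> the leading coefficients cancel; beyond it both
        coefficients are zero.\<close>
      have "coeff g k + coeff h k = 0"
        using k lead d deg by (cases "k = Suc d") (auto simp: coeff_eq_0)
      then show "coeff p i = 0" using k d by (simp add: p coeff_eq_0)
    qed
    show "Suc (Suc d) \<le> degree p" using 1 by (intro le_degree) simp
  qed
  ultimately show ?thesis using d deg(2) by (intro bexI[of _ p]) auto
qed

text \<open>If \<open>g\<close> or \<open>h\<close> has even degree, it is itself a witness.
  Otherwise both degrees are odd, and multiplying by even powers of \<open>t\<close> and positive
  constants gives a common degree and leading coefficients -1 and 1, ready for cancellation.\<close>

lemma exists_even_degree_negative: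
  assumes P: "poly_quadratic_module P" and gh: "g \<in> P" "h \<in> P"
    and neg: "lead_coeff g < 0" "lead_coeff (poly_reflect h) < 0"
  shows "\<exists>p\<in>P. even (degree p) \<and> lead_coeff p < 0"
proof (cases "even (degree g) \<or> even (degree h)")
  case True
  then show ?thesis using assms lead_coeff_poly_reflect[of h] by (cases "even (degree g)") auto
next
  case False
  then have odd: "odd (degree g)" "odd (degree h)" by auto
  have h: "0 < lead_coeff h" using neg(2) odd unfolding lead_coeff_poly_reflect by simp
  define m where "m = max (degree g) (degree h)"
  have shift: "\<exists>q\<in>P. degree q = m \<and> lead_coeff q = sgn (lead_coeff p)"
    if p: "p \<in> P" "p \<noteq> 0" "odd (degree p)" "degree p \<le> m" for p
  proof -
    have "odd m" using odd by (simp add: m_def max_def)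
    then have "even (m - degree p)" using p by simp
    then obtain k where k: "m = degree p + 2 * k" using p(4) by (metis evenE le_add_diff_inverse)
    define q where "q = Polynomial.smult (1 / \<bar>lead_coeff p\<bar>) ((monom 1 k)\<^sup>2 * p)"
    have "q \<in> P"
      unfolding q_def by (intro poly_quadratic_module_smult[OF P] poly_quadratic_moduleD[OF P] p) auto
    moreover have "degree q = m"
      using p(2) by (simp add: q_def k degree_mult_eq degree_power_eq degree_monom_eq monom_eq_0_iff)
    moreover have "lead_coeff q = sgn (lead_coeff p)"
      unfolding q_def lead_coeff_smult lead_coeff_mult lead_coeff_power
      by (simp add: degree_monom_eq sgn_div_norm field_simps)
    ultimately show ?thesis by blast
  qed
  obtain g' h' where "g' \<in> P" "degree g' = m" "lead_coeff g' = -1"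
    and "h' \<in> P" "degree h' = m" "lead_coeff h' = 1"
    using shift[of g] shift[of h] gh odd neg(1) h by (fastforce simp: m_def)
  moreover have "odd m" using odd by (simp add: m_def max_def)
  ultimately show ?thesis by (intro cancel_odd_degree[OF P, of g' h']) auto
qed

lemma poly_quadratic_module_archimedean:
  assumes P: "poly_quadratic_module P" and gh: "g \<in> P" "h \<in> P"
    and neg: "lead_coeff g < 0" "lead_coeff (poly_reflect h) < 0"
  shows "\<exists>k::nat. of_nat k - f \<in> P"
proof -
  obtain p where p: "p \<in> P" "even (degree p)" "lead_coeff p < 0"
    using exists_even_degree_negative[OF assms] by blast
  \<comment> \<open>Large enough that \<open>q\<close> has greater degree than \<open>f\<close>, so
    \<open>- q - f\<close> has the leading term of \<open>- q\<close> and attains a minimum.\<close>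
  define m where "m = Suc (degree f)"
  define q where "q = (monom 1 m)\<^sup>2 * p"
  have "q \<in> P" unfolding q_def by (intro poly_quadratic_moduleD[OF P] p)
  have q: "degree q = 2 * m + degree p" "lead_coeff q = lead_coeff p"
  proof -
    have "monom 1 m ^ 2 = (monom 1 (2 * m) :: real poly)" by (simp add: monom_power mult.commute)
    moreover have "p \<noteq> 0" using p(3) by auto
    ultimately show "degree q = 2 * m + degree p" "lead_coeff q = lead_coeff p"
      unfolding q_def lead_coeff_mult by (simp_all add: degree_mult_eq degree_monom_eq monom_eq_0_iff)
  qed
  have "degree f < degree (- q)" using q by (simp add: m_def)
  then have "degree (- q - f) = degree q" "lead_coeff (- q - f) = - lead_coeff p"
    using degree_diff_eq_left[of f "- q"] lead_coeff_diff_eq_left[of f "- q"] q by auto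
  then obtain a where a: "\<And>x. poly (- q - f) a \<le> poly (- q - f) x"
    using poly_attains_min[of "- q - f"] q p by auto
  \<comment> \<open>Minus the minimum of \<open>- q - f\<close> is the maximum of
    \<open>f + q\<close>, so \<open>k - f - q\<close> is nonnegative everywhere.\<close>
  obtain k :: nat where "- poly (- q - f) a \<le> real k" using real_arch_simple by blast
  then have "0 \<le> poly (of_nat k - f - q) x" for x
    using a[of x] by simp
  then have "of_nat k - f - q \<in> P" by (rule nonneg_poly_in_poly_quadratic_module[OF P])
  then have "(of_nat k - f - q) + q \<in> P" using \<open>q \<in> P\<close> by (rule poly_quadratic_moduleD[OF P])
  then show ?thesis by auto
qed

section \<open>Scalar and rank-one members of matrix quadratic modules\<close>

lemma congruence_index:
  assumes "A \<in> carrier_mat n n" "B \<in> carrier_mat n n" "r < n" "c < n"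
  shows "(transpose_mat A * B * A) $$ (r, c)
    = (\<Sum>j<n. (\<Sum>i<n. A $$ (i, r) * B $$ (i, j)) * A $$ (j, c))"
  using assms
  by (simp add: scalar_prod_def atLeast0LessThan del: assoc_mult_mat)

lemma quadratic_moduleD:
  assumes "quadratic_module n M"
  shows "1\<^sub>m n \<in> M" "B \<in> M \<Longrightarrow> C \<in> M \<Longrightarrow> B + C \<in> M"
    "A \<in> carrier_mat n n \<Longrightarrow> B \<in> M \<Longrightarrow> transpose_mat A * B * A \<in> M"
    "B \<in> M \<Longrightarrow> B \<in> carrier_mat n n"
  using assms by (auto simp: quadratic_module_def symmetric_mats_def)

text \<open>The sum is entrywise: matrices of all sizes share one type, so no single zero matrix
  could start it.\<close>

lemma quadratic_module_sum:
  assumes M: "quadratic_module n M" and "finite K" "\<And>k. k \<in> K \<Longrightarrow> B k \<in> M"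
  shows "mat n n (\<lambda>ij. \<Sum>k\<in>K. B k $$ ij) \<in> M"
  using assms(2,3)
proof (induction K)
  case empty
  have "mat n n (\<lambda>ij. 0) = congruence_sum n []" by auto
  then show ?case using congruence_sum_in_quadratic_module[OF M, of "[]"] by simp
next
  case (insert k K)
  have "mat n n (\<lambda>ij. \<Sum>l\<in>insert k K. B l $$ ij) = B k + mat n n (\<lambda>ij. \<Sum>l\<in>K. B l $$ ij)"
    using insert quadratic_moduleD(4)[OF M, of "B k"] by (intro eq_matI) auto
  then show ?case using insert quadratic_moduleD(2)[OF M] by simp
qed

text \<open>Let \<open>A k\<close> have \<open>v\<close> as column \<open>k\<close> and zeros
  elsewhere. Congruence by \<open>A k\<close> puts the value of the form at diagonal position
  \<open>k\<close>, and summing over \<open>k\<close> fills the diagonal.\<close>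

lemma qform_in_quadratic_module:
  assumes M: "quadratic_module n M" and G: "G \<in> M"
  shows "qform n (\<lambda>i j. G $$ (i, j)) v \<cdot>\<^sub>m 1\<^sub>m n \<in> M"
proof -
  let ?q = "qform n (\<lambda>i j. G $$ (i, j)) v"
  define A where "A k = mat n n (\<lambda>(r, c). if c = k then v r else 0)" for k
  have Gc: "G \<in> carrier_mat n n" by (rule quadratic_moduleD(4)[OF M G])
  have A: "A k \<in> carrier_mat n n" for k by (simp add: A_def)
  have entry: "(transpose_mat (A k) * G * A k) $$ (r, c) = (if r = k \<and> c = k then ?q else 0)"
    if "r < n" "c < n" for k r c
  proof -
    have "(\<Sum>j<n. (\<Sum>i<n. v i * G $$ (i, j)) * v j) = (\<Sum>j<n. \<Sum>i<n. G $$ (i, j) * v i * v j)"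
      by (simp add: sum_distrib_left mult_ac)
    also have "\<dots> = ?q" unfolding qform_def by (rule sum.swap)
    finally show ?thesis
      unfolding congruence_index[OF A Gc that] using that by (auto simp: A_def)
  qed
  have "mat n n (\<lambda>ij. \<Sum>k<n. (transpose_mat (A k) * G * A k) $$ ij) \<in> M"
    by (rule quadratic_module_sum[OF M]) (auto intro: quadratic_moduleD[OF M] A G)
  moreover have "mat n n (\<lambda>ij. \<Sum>k<n. (transpose_mat (A k) * G * A k) $$ ij) = ?q \<cdot>\<^sub>m 1\<^sub>m n"
  proof (rule eq_matI)
    fix i j assume "i < dim_row (?q \<cdot>\<^sub>m 1\<^sub>m n)" "j < dim_col (?q \<cdot>\<^sub>m 1\<^sub>m n)"
    then show "mat n n (\<lambda>ij. \<Sum>k<n. (transpose_mat (A k) * G * A k) $$ ij) $$ (i, j)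
        = (?q \<cdot>\<^sub>m 1\<^sub>m n) $$ (i, j)"
      by (cases "i = j") (auto simp: entry intro!: sum.neutral simp del: index_mult_mat)
  qed auto
  ultimately show ?thesis by simp
qed

text \<open>Makes the results on polynomials available for matrices: congruence of
  \<open>p I\<close> by \<open>a I\<close> gives \<open>(a\<^sup>2 * p) I\<close>.\<close>

lemma scalar_poly_quadratic_module:
  assumes M: "quadratic_module n M"
  shows "poly_quadratic_module {p. p \<cdot>\<^sub>m 1\<^sub>m n \<in> M}"
proof -
  have "p \<cdot>\<^sub>m 1\<^sub>m n + q \<cdot>\<^sub>m 1\<^sub>m n = (p + q) \<cdot>\<^sub>m 1\<^sub>m n" for p q :: "real poly"
    by (intro eq_matI) auto
  moreover have "transpose_mat (a \<cdot>\<^sub>m 1\<^sub>m n) * (p \<cdot>\<^sub>m 1\<^sub>m n) * (a \<cdot>\<^sub>m 1\<^sub>m n) = (a\<^sup>2 * p) \<cdot>\<^sub>m 1\<^sub>m n"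
    for a p :: "real poly"
    by (intro eq_matI) (auto simp: power2_eq_square)
  moreover have "(1::real poly) \<cdot>\<^sub>m 1\<^sub>m n = 1\<^sub>m n" by auto
  ultimately show ?thesis
    unfolding poly_quadratic_module_def
    using quadratic_moduleD[OF M] by (metis (no_types, lifting) mem_Collect_eq one_carrier_mat smult_carrier_mat)
qed

text \<open>The outer product is the congruence of the identity by the matrix with row 0 equal to
  \<open>u\<close> and zeros elsewhere.\<close>

lemma rank_one_in_quadratic_module:
  assumes M: "quadratic_module n M" and "n \<ge> 1"
  shows "mat n n (\<lambda>(r, c). u r * u c) \<in> M"
proof -
  define A where "A = mat n n (\<lambda>(r, c). if r = 0 then u c else 0)"
  have A: "A \<in> carrier_mat n n" by (simp add: A_def)
  have "(transpose_mat A * 1\<^sub>m n * A) $$ (r, c) = u r * u c" if "r < n" "c < n" for r c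
    unfolding congruence_index[OF A one_carrier_mat that] using that assms(2)
    by (simp add: A_def if_distrib[of "(*) _"] cong: if_cong)
  then have "transpose_mat A * 1\<^sub>m n * A = mat n n (\<lambda>(r, c). u r * u c)"
    using A by (intro eq_matI) (auto simp del: index_mult_mat(1))
  then show ?thesis using quadratic_moduleD(3)[OF M A quadratic_moduleD(1)[OF M]] by simp
qed

text \<open>Lagrange's identity
  \<open>\<bar>a\<bar>\<^sup>2 \<bar>v\<bar>\<^sup>2 - (a \<bullet> v)\<^sup>2 = 1/2 (\<Sum>i j. (a\<^sub>i v\<^sub>j - a\<^sub>j v\<^sub>i)\<^sup>2)\<close> for each row \<open>a\<close> of the matrix.\<close>

lemma frobenius_bound_in_quadratic_module:
  assumes M: "quadratic_module n M" and n: "n \<ge> 1" and A: "A \<in> carrier_mat n n"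
  shows "(\<Sum>k<n. \<Sum>i<n. (A $$ (k, i))\<^sup>2) \<cdot>\<^sub>m 1\<^sub>m n - transpose_mat A * A \<in> M"
proof -
  let ?f = "\<Sum>k<n. \<Sum>i<n. (A $$ (k, i))\<^sup>2"
  define \<delta> :: "nat \<Rightarrow> nat \<Rightarrow> real poly" where "\<delta> i j = (if i = j then 1 else 0)" for i j
  \<comment> \<open>This is the vector \<open>(a_i e_j - a_j e_i) / sqrt 2\<close> for row
    \<open>a\<close> number \<open>k\<close>; its outer product realises one square of the identity,
    factor 1/2 included.\<close>
  define u where "u = (\<lambda>(k, i, j) r.
    Polynomial.smult (sqrt (1 / 2)) (A $$ (k, i) * \<delta> j r - A $$ (k, j) * \<delta> i r))"
  define B where "B l = mat n n (\<lambda>(r, c). u l r * u l c)" for l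
  let ?K = "{..<n} \<times> {..<n} \<times> {..<n}"
  have row: "(\<Sum>i<n. \<Sum>j<n. u (k, i, j) r * u (k, i, j) c)
      = \<delta> r c * (\<Sum>i<n. (A $$ (k, i))\<^sup>2) - A $$ (k, r) * A $$ (k, c)"
    if rc: "r < n" "c < n" for k r c
  proof -
    let ?a = "\<lambda>i. A $$ (k, i)"
    have pick: "(\<Sum>i<n. f i * \<delta> i m) = f m" if "m < n" for f m
      using that by (simp add: \<delta>_def if_distrib[of "(*) _"] cong: if_cong)
    \<comment> \<open>Each product is bracketed so that \<open>pick\<close> collapses the sums one
      delta at a time.\<close>
    have "u (k, i, j) r * u (k, i, j) c = [:1 / 2:] *
        (((?a i)\<^sup>2 * \<delta> j r) * \<delta> j c - (?a i * \<delta> i c) * (?a j * \<delta> j r)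
        - (?a i * \<delta> i r) * (?a j * \<delta> j c) + ((?a j)\<^sup>2 * \<delta> i r) * \<delta> i c)" for i j
      by (simp add: u_def power2_eq_square algebra_simps
          Polynomial.smult_add_right Polynomial.smult_diff_right flip: real_sqrt_mult)
    then have "(\<Sum>i<n. \<Sum>j<n. u (k, i, j) r * u (k, i, j) c) = [:1 / 2:] *
        (\<Sum>i<n. \<Sum>j<n. ((?a i)\<^sup>2 * \<delta> j r) * \<delta> j c - (?a i * \<delta> i c) * (?a j * \<delta> j r)
        - (?a i * \<delta> i r) * (?a j * \<delta> j c) + ((?a j)\<^sup>2 * \<delta> i r) * \<delta> i c)"
      by (simp only: sum_distrib_left)
    also have "(\<Sum>i<n. \<Sum>j<n. ((?a i)\<^sup>2 * \<delta> j r) * \<delta> j c - (?a i * \<delta> i c) * (?a j * \<delta> j r)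
        - (?a i * \<delta> i r) * (?a j * \<delta> j c) + ((?a j)\<^sup>2 * \<delta> i r) * \<delta> i c)
      = (\<Sum>i<n. (?a i)\<^sup>2) * \<delta> c r - ?a c * ?a r - ?a r * ?a c + (\<Sum>j<n. (?a j)\<^sup>2) * \<delta> c r"
      using rc by (simp only: sum.distrib sum_subtractf pick
          sum_distrib_left[symmetric] sum_distrib_right[symmetric])
    also have "[:1 / 2:] * \<dots> = \<delta> r c * (\<Sum>i<n. (?a i)\<^sup>2) - ?a r * ?a c"
    proof -
      have "[:1 / 2:] * (x - y - y + x) = (x - y :: real poly)" for x y
        by (rule iffD1[OF poly_eq_poly_eq_iff], rule ext) (simp add: field_simps)
      moreover have "\<delta> c r = \<delta> r c" by (simp add: \<delta>_def)
      ultimately show ?thesis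
        by (simp only: mult.commute[of _ "\<delta> r c"] mult.commute[of "?a c" "?a r"])
    qed
    finally show ?thesis .
  qed
  have "mat n n (\<lambda>ij. \<Sum>l\<in>?K. B l $$ ij) \<in> M"
    by (rule quadratic_module_sum[OF M]) (auto simp: B_def intro: rank_one_in_quadratic_module[OF M n])
  moreover have "mat n n (\<lambda>ij. \<Sum>l\<in>?K. B l $$ ij) = ?f \<cdot>\<^sub>m 1\<^sub>m n - transpose_mat A * A"
  proof (rule eq_matI)
    fix r c assume "r < dim_row (?f \<cdot>\<^sub>m 1\<^sub>m n - transpose_mat A * A)"
      "c < dim_col (?f \<cdot>\<^sub>m 1\<^sub>m n - transpose_mat A * A)"
    then have rc: "r < n" "c < n" using A by auto
    have "(\<Sum>l\<in>?K. B l $$ (r, c)) = (\<Sum>k<n. \<Sum>i<n. \<Sum>j<n. u (k, i, j) r * u (k, i, j) c)"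
      using rc by (simp add: B_def sum.cartesian_product)
    also have "\<dots> = \<delta> r c * ?f - (\<Sum>k<n. A $$ (k, r) * A $$ (k, c))"
      by (simp add: row[OF rc] sum_subtractf sum_distrib_left)
    also have "\<dots> = (?f \<cdot>\<^sub>m 1\<^sub>m n - transpose_mat A * A) $$ (r, c)"
      using rc A by (simp add: \<delta>_def scalar_prod_def atLeast0LessThan)
    finally show "mat n n (\<lambda>ij. \<Sum>l\<in>?K. B l $$ ij) $$ (r, c)
        = (?f \<cdot>\<^sub>m 1\<^sub>m n - transpose_mat A * A) $$ (r, c)"
      using rc by simp
  qed (use A in auto)
  ultimately show ?thesis by simp
qed

section \<open>From the locus to negative values of the forms\<close>

lemma positive_semidefinite_eval_mat:
  assumes G: "G \<in> symmetric_mats n"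
    and nonneg: "\<And>v. 0 \<le> qform n (\<lambda>i j. poly (G $$ (i, j)) x) v"
  shows "positive_semidefinite n (eval_mat G x)"
  unfolding positive_semidefinite_def
proof (intro conjI ballI)
  have Gc: "G \<in> carrier_mat n n" and sym: "transpose_mat G = G"
    using G by (auto simp: symmetric_mats_def)
  have "transpose_mat (eval_mat G x) = eval_mat (transpose_mat G) x"
    by (intro eq_matI) (auto simp: eval_mat_def)
  then show "eval_mat G x \<in> symmetric_mats n"
    using Gc sym by (simp add: symmetric_mats_def eval_mat_def)
  fix v :: "real vec" assume v: "v \<in> carrier_vec n"
  have "v \<bullet> (eval_mat G x *\<^sub>v v) = qform n (\<lambda>i j. poly (G $$ (i, j)) x) (\<lambda>i. v $ i)"
    using v Gc by (auto simp: qform_def scalar_prod_def eval_mat_def atLeast0LessThan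
        sum_distrib_left mult_ac intro!: sum.cong)
  then show "0 \<le> v \<bullet> (eval_mat G x *\<^sub>v v)" using nonneg by simp
qed

text \<open>Contrapositive of \<open>qform_eventually_nonneg\<close>; finiteness gives one threshold
  for all generators. The two choices of \<open>\<sigma>\<close> serve the two ends of the
  line.\<close>

lemma exists_negative_qform:
  fixes \<G> :: "real poly mat set"
  assumes "finite \<G>" and sym: "\<G> \<subseteq> symmetric_mats n"
    and \<sigma>: "\<sigma> = id \<or> \<sigma> = poly_reflect"
    and ev: "\<forall>\<^sub>F x in at_top. \<exists>G\<in>\<G>. \<exists>v. qform n (\<lambda>i j. poly (\<sigma> (G $$ (i, j))) x) v < 0"
  shows "\<exists>G\<in>\<G>. \<exists>v. lead_coeff (\<sigma> (qform n (\<lambda>i j. G $$ (i, j)) v)) < 0"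
proof (rule ccontr)
  assume no: "\<not> ?thesis"
  have "\<forall>\<^sub>F x in at_top. \<forall>v. 0 \<le> qform n (\<lambda>i j. poly (\<sigma> (G $$ (i, j))) x) v" if G: "G \<in> \<G>" for G
  proof -
    \<comment> \<open>Extension by zero, because the induction asks for symmetry at all indices,
      including those outside the matrix.\<close>
    define H where "H i j = (if i < n \<and> j < n then G $$ (i, j) else 0)" for i j
    have "transpose_mat G = G" "G \<in> carrier_mat n n"
      using G sym by (auto simp: symmetric_mats_def)
    then have "H i j = H j i" for i j
      unfolding H_def using index_transpose_mat(1)[of i G j] by auto
    moreover have H: "qform n H v = qform n (\<lambda>i j. G $$ (i, j)) v" for v
      by (simp add: qform_def H_def)
    have "0 \<le> qform n (\<lambda>i j. \<sigma> (H i j)) v" for v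
    proof -
      have "poly_reflect (poly_reflect p) = p" for p
        by (rule iffD1[OF poly_eq_poly_eq_iff], rule ext) simp
      \<comment> \<open>Reflection is an involution, so every vector is the reflection of some
        \<open>w\<close>, and values of the reflected form are reflected values.\<close>
      then obtain w where "qform n (\<lambda>i j. \<sigma> (H i j)) v = \<sigma> (qform n H w)"
        using \<sigma> qform_poly_reflect[of n H "\<lambda>i. poly_reflect (v i)"]
        by (elim disjE) (auto intro: that[of v] that[of "\<lambda>i. poly_reflect (v i)"])
      moreover have "\<not> lead_coeff (\<sigma> (qform n H w)) < 0"
        using no G unfolding H by blast
      ultimately show ?thesis
        by (auto simp: less_eq_poly_def pos_poly_def)
    qed
    ultimately have "\<forall>\<^sub>F x in at_top. \<forall>v. 0 \<le> qform n (\<lambda>i j. poly (\<sigma> (H i j)) x) v"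
      by (intro qform_eventually_nonneg) auto
    then show ?thesis by (simp add: qform_def H_def)
  qed
  then have "\<forall>\<^sub>F x in at_top. \<forall>G\<in>\<G>. \<forall>v. 0 \<le> qform n (\<lambda>i j. poly (\<sigma> (G $$ (i, j))) x) v"
    using assms(1) by (simp add: eventually_ball_finite)
  with ev have "\<forall>\<^sub>F x in at_top :: real filter. False"
    by eventually_elim (auto simp: not_le[symmetric])
  then show False by simp
qed

theorem proposition5p7:
  fixes n :: nat and \<G> :: "real poly mat set"
  assumes "n \<ge> 1"
    and "finite \<G>"
    and "\<G> \<subseteq> symmetric_mats n"
    and "compact (psd_locus n \<G>)"
  shows "archimedean n (generated_quadratic_module n \<G>)"
proof -
  let ?M = "generated_quadratic_module n \<G>"
  have M: "quadratic_module n ?M" and GM: "\<G> \<subseteq> ?M"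
    using generated_quadratic_module_least(1,2)[OF assms(3)] .
  define P where "P = {p. p \<cdot>\<^sub>m 1\<^sub>m n \<in> ?M}"
  have P: "poly_quadratic_module P"
    unfolding P_def by (rule scalar_poly_quadratic_module[OF M])
  have qP: "qform n (\<lambda>i j. G $$ (i, j)) v \<in> P" if "G \<in> \<G>" for G v
    unfolding P_def using qform_in_quadratic_module[OF M] GM that by blast
  have "\<exists>b. \<forall>x\<in>psd_locus n \<G>. \<bar>x\<bar> \<le> b"
  proof (cases "psd_locus n \<G> = {}")
    case False
    have "compact (abs ` psd_locus n \<G>)"
      using assms(4) by (intro compact_continuous_image continuous_intros)
    then show ?thesis using compact_attains_sup[of "abs ` psd_locus n \<G>"] False by auto
  qed simp
  then obtain b where b: "\<And>x. x \<in> psd_locus n \<G> \<Longrightarrow> \<bar>x\<bar> \<le> b" by blast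
  have out: "\<exists>G\<in>\<G>. \<exists>v. qform n (\<lambda>i j. poly (G $$ (i, j)) x) v < 0" if "b < \<bar>x\<bar>" for x
  proof (rule ccontr)
    assume "\<not> ?thesis"
    then have "x \<in> psd_locus n \<G>"
      using positive_semidefinite_eval_mat assms(3) by (force simp: psd_locus_def not_less)
    with b that show False by force
  qed
  have "\<forall>\<^sub>F x in at_top. \<exists>G\<in>\<G>. \<exists>v. qform n (\<lambda>i j. poly (id (G $$ (i, j))) x) v < 0"
    using eventually_gt_at_top[of b] by eventually_elim (use out in fastforce)
  from exists_negative_qform[OF assms(2,3) disjI1[OF refl] this]
  obtain g where g: "g \<in> P" "lead_coeff g < 0" unfolding id_apply using qP by blast
  \<comment> \<open>Reflected entries at \<open>x\<close> are the entries at \<open>- x\<close>,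
    which also lies outside the bound \<open>b\<close>.\<close>
  have "\<forall>\<^sub>F x in at_top. \<exists>G\<in>\<G>. \<exists>v. qform n (\<lambda>i j. poly (poly_reflect (G $$ (i, j))) x) v < 0"
    using eventually_gt_at_top[of b] by eventually_elim (use out in fastforce)
  from exists_negative_qform[OF assms(2,3) disjI2[OF refl] this]
  obtain h where h: "h \<in> P" "lead_coeff (poly_reflect h) < 0" using qP by blast
  show ?thesis
    unfolding archimedean_def
  proof
    fix A :: "real poly mat" assume A: "A \<in> carrier_mat n n"
    define f where "f = (\<Sum>k<n. \<Sum>i<n. (A $$ (k, i))\<^sup>2)"
    obtain k :: nat where k: "of_nat k - f \<in> P"
      using poly_quadratic_module_archimedean[OF P g(1) h(1) g(2) h(2)] by blast
    have "(of_nat k - f) \<cdot>\<^sub>m 1\<^sub>m n + (f \<cdot>\<^sub>m 1\<^sub>m n - transpose_mat A * A) \<in> ?M"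
      using k frobenius_bound_in_quadratic_module[OF M assms(1) A]
      by (intro quadratic_moduleD(2)[OF M]) (auto simp: P_def f_def)
    also have "(of_nat k - f) \<cdot>\<^sub>m 1\<^sub>m n + (f \<cdot>\<^sub>m 1\<^sub>m n - transpose_mat A * A)
        = of_nat k \<cdot>\<^sub>m 1\<^sub>m n - transpose_mat A * A"
      using A by (intro eq_matI) (auto simp: algebra_simps)
    finally show "\<exists>k::nat. of_nat k \<cdot>\<^sub>m 1\<^sub>m n - transpose_mat A * A \<in> ?M" by blast
  qed
qed

end
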